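(* Let $\mathcal{A},\mathcal{B}$ be finite non-empty alphabets, let $\sigma:\mathcal{A}^*\to\mathcal{B}^*$ be any non-erasing monoid morphism, and let $\mu$ be any invariant measure on $\mathcal{A}^{\mathbb{Z}}$. Then for any $w'\in\mathcal{B}^*$ with $|w'|\ge2$ the transferred measure $\mu^\sigma:=\sigma^{\mathcal{M}}(\mu)$, evaluated on the cylinder $[w']$, is given by the finite sum $$\mu^\sigma([w'])=\sum_{w\in W(w')}\lfloor\sigma(w)\rfloor_{w'}\cdot\mu([w]),$$ where $$W(w')=\Big\{w\in\mathcal{A}^*:\ |w|\le\frac{|w'|-2}{\min\{|\sigma(a_k)|:a_k\in\mathcal{A}\}}+2\Big\}.$$
   Context: For a finite non-empty alphabet $\mathcal{A}$, $\mathcal{A}^*$ is the free monoid of finite words, $|w|$ is word length. The full shift $\mathcal{A}^{\mathbb{Z}}$ carries the product topology and the shift $T$, $(T\mathbf{x})_k=x_{k+1}$. The cylinder of $w$ is $[w]=\{\mathbf{x}: x_1\cdots x_{|w|}=w\}$. An invariant measure is a finite $T$-invariant Borel measure; $\mathcal{M}(\mathcal{A}^{\mathbb{Z}})$ is the set of those. A monoid morphism $\sigma:\mathcal{A}^*\to\mathcal{B}^*$ is non-erasing if $|\sigma(a)|\ge1$ for all $a\in\mathcal{A}$. Essential occurrences: let $w=x_1\cdots x_n\in\mathcal{A}^*$ with $x_i\in\mathcal{A}$, $n\ge1$. An occurrence of a non-empty word $w'$ as a factor (contiguous subword) of $\sigma(w)=\sigma(x_1)\cdots\sigma(x_n)$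 is essential if its first letter lies in the block $\sigma(x_1)$ and its last letter lies in the block $\sigma(x_n)$. $\lfloor\sigma(w)\rfloor_{w'}$ denotes the number of essential occurrences of $w'$ in $\sigma(w)$ (it depends on $w$, not just on the word $\sigma(w)$); it is $0$ if $w$ is the empty word. Measure transfer: for non-erasing $\sigma$ let $\mathcal{A}_\sigma$ be the alphabet of letters $a(k)$ with $a\in\mathcal{A}$, $1\le k\le|\sigma(a)|$; let $\pi_\sigma:\mathcal{A}^*\to\mathcal{A}_\sigma^*$, $a\mapsto a(1)a(2)\cdots a(|\sigma(a)|)$, and let $\alpha_\sigma:\mathcal{A}_\sigma^*\to\mathcal{B}^*$ send $a(k)$ to the $k$-th letter of $\sigma(a)$, so that $\sigma=\alpha_\sigma\circ\pi_\sigma$. For a non-empty word $u\in\mathcal{A}_\sigma^*$ let $\hat u\in\mathcal{A}^*$ be the shortest word such that $u$ is a factor of $\pi_\sigma(\hat u)$ (it is unique if it exists); if no such word exists, put formally $\mu([\hat u])=0$. For $\mu\in\mathcal{M}(\mathcal{A}^{\mathbb{Z}})$, the transferred measure $\mu^\sigma=\sigma^{\mathcal{M}}(\mu)\in\mathcal{M}(\mathcal{B}^{\mathbb{Z}})$ is the invariant measure determined by $\mu^\sigma([w])=\sum_{u\in\alpha_\sigma^{-1}(w)}\mu([\hat u])$ for all non-empty $w\in\mathcal{B}^*$. *)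

theory Defs
  imports "HOL-Analysis.Analysis" "HOL-Library.Sublist"
begin

text \<open>
  An alphabet is a type of class \<open>finite\<close> (non-empty, as all types are), the free monoid over it is
  the type of lists, and its full shift is the type of functions from \<open>int\<close> to the alphabet.
\<close>

definition shift :: "(int \<Rightarrow> 'a) \<Rightarrow> int \<Rightarrow> 'a" where
  "shift x = (\<lambda>k. x (k + 1))"

definition cylinder :: "'a list \<Rightarrow> (int \<Rightarrow> 'a) set" where
  "cylinder w = {x. map x [1..int (length w)] = w}"

definition shift_topology :: "(int \<Rightarrow> 'a) topology" where
  "shift_topology = product_topology (\<lambda>_. discrete_topology UNIV) UNIV"

definition invariant_measures :: "(int \<Rightarrow> 'a) measure set" where
  "invariant_measures = {\<mu>. sets \<mu> = sigma_sets UNIV {U. openin shift_topology U} \<and>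
     finite_measure \<mu> \<and> (\<forall>X\<in>sets \<mu>. emeasure \<mu> (shift -` X) = emeasure \<mu> X)}"

definition monoid_morphism :: "('a list \<Rightarrow> 'b list) \<Rightarrow> bool" where
  "monoid_morphism \<sigma> \<longleftrightarrow> \<sigma> [] = [] \<and> (\<forall>u v. \<sigma> (u @ v) = \<sigma> u @ \<sigma> v)"

definition non_erasing :: "('a list \<Rightarrow> 'b list) \<Rightarrow> bool" where
  "non_erasing \<sigma> \<longleftrightarrow> (\<forall>a. 1 \<le> length (\<sigma> [a]))"

text \<open>
  An occurrence of \<open>w'\<close> in \<open>\<sigma> w\<close> is a factorisation \<open>\<sigma> w = p @ w' @ s\<close>.  For non-empty \<open>w'\<close> its first
  letter lies in the first block \<open>\<sigma> [hd w]\<close> iff \<open>p\<close> is shorter than that block, and its last letter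
  lies in the last block \<open>\<sigma> [last w]\<close> iff \<open>s\<close> is shorter than that block.
\<close>

definition essential_occurrences :: "('a list \<Rightarrow> 'b list) \<Rightarrow> 'a list \<Rightarrow> 'b list \<Rightarrow> nat" where
  "essential_occurrences \<sigma> w w' =
     (if w = [] then 0
      else card {(p, s). \<sigma> w = p @ w' @ s \<and>
                   length p < length (\<sigma> [hd w]) \<and> length s < length (\<sigma> [last w])})"

text \<open>The letter \<open>a(k)\<close> of the subdivision alphabet is the pair \<open>(a, k)\<close>, with \<open>k\<close> counted from 1.\<close>

definition subdivision_alphabet :: "('a list \<Rightarrow> 'b list) \<Rightarrow> ('a \<times> nat) set" where
  "subdivision_alphabet \<sigma> = {(a, k). 1 \<le> k \<and> k \<le> length (\<sigma> [a])}"

definition subdivision :: "('a list \<Rightarrow> 'b list) \<Rightarrow> 'a list \<Rightarrow> ('a \<times> nat) list" where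
  "subdivision \<sigma> v = concat (map (\<lambda>a. map (\<lambda>k. (a, k)) [1..<length (\<sigma> [a]) + 1]) v)"

definition letter_map :: "('a list \<Rightarrow> 'b list) \<Rightarrow> ('a \<times> nat) list \<Rightarrow> 'b list" where
  "letter_map \<sigma> u = map (\<lambda>(a, k). \<sigma> [a] ! (k - 1)) u"

definition covering_word :: "('a list \<Rightarrow> 'b list) \<Rightarrow> ('a \<times> nat) list \<Rightarrow> 'a list" where
  "covering_word \<sigma> u = (ARG_MIN length v. sublist u (subdivision \<sigma> v))"

definition covering_measure ::
    "('a list \<Rightarrow> 'b list) \<Rightarrow> (int \<Rightarrow> 'a) measure \<Rightarrow> ('a \<times> nat) list \<Rightarrow> real" where
  "covering_measure \<sigma> \<mu> u =
     (if \<exists>v. sublist u (subdivision \<sigma> v) then measure \<mu> (cylinder (covering_word \<sigma> u)) else 0)"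

text \<open>
  For non-erasing \<open>\<sigma>\<close> and invariant \<open>\<mu>\<close> there is exactly one such measure: its values on the cylinders,
  which all start at position 1, determine it by shift invariance.  Otherwise the value is arbitrary.
\<close>

definition transfer :: "('a list \<Rightarrow> 'b list) \<Rightarrow> (int \<Rightarrow> 'a) measure \<Rightarrow> (int \<Rightarrow> 'b) measure" where
  "transfer \<sigma> \<mu> = (THE \<nu>. \<nu> \<in> invariant_measures \<and>
     (\<forall>w. w \<noteq> [] \<longrightarrow> measure \<nu> (cylinder w) =
        (\<Sum>u\<in>{u \<in> lists (subdivision_alphabet \<sigma>). letter_map \<sigma> u = w}. covering_measure \<sigma> \<mu> u)))"

definition W :: "('a list \<Rightarrow> 'b list) \<Rightarrow> 'b list \<Rightarrow> 'a list set" where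
  "W \<sigma> w' = {w. real (length w) \<le>
      (real (length w') - 2) / real (Min (range (\<lambda>a. length (\<sigma> [a])))) + 2}"

end

theory Submission
  imports Defs
begin

text \<open>
  The formula itself is a regrouping.  The transferred measure of \<open>[w']\<close> is a sum of the numbers
  \<open>\<mu>([v])\<close> over the words \<open>u\<close> that the letter map sends to \<open>w'\<close>, where \<open>v\<close> is the covering word
  of \<open>u\<close>; collect the \<open>u\<close> that have a given covering word \<open>w\<close>.  A covering word is shortest, so it cannot lose its first or its last
  letter, which says that \<open>u\<close> starts in the first block of \<open>\<pi>(w)\<close> and ends in the last one.
  Conversely a factor in such a position determines \<open>w\<close>: its letters \<open>a(1)\<close> mark where the blocks
  begin, and the first letter of \<open>u\<close> names the block that was entered in its middle
  (\<open>essential_factor_decode\<close>).  Hence the \<open>u\<close> over \<open>w'\<close> with covering word \<open>w\<close> are in bijection with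
  the essential occurrences of \<open>w'\<close> in \<open>\<sigma>(w)\<close> (\<open>essential_occurrences_eq_card\<close>).  The inner blocks of
  \<open>w\<close> lie inside such a \<open>u\<close>, together with a letter on either side, which bounds the length
  of \<open>w\<close> (\<open>essential_factor_imp_W\<close>).

  The transferred measure is given by a definite description, so the defining sum becomes available
  only once exactly one invariant measure is known to satisfy it.  Uniqueness holds because
  the cylinders over symmetric windows form, with the empty set, a countable intersection-stable
  generator and are shifts of the cylinders \<open>[w]\<close> (\<open>invariant_measure_eqI\<close>).
  For existence, put over each point \<open>x\<close> a column of \<open>|\<sigma>(x\<^sub>1)|\<close> levels.  Going up one level, or from the top of the column of \<open>x\<close> to the
  bottom of that of \<open>T x\<close>, corresponds to shifting \<open>\<sigma>(x)\<close> by one letter.  Reading letters along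
  orbits maps this tower to the target shift, and the image of the measure \<open>\<mu> \<times> counting\<close> is
  invariant, since one step only exchanges the levels \<open>(x, 0)\<close> for the levels \<open>(T x, 0)\<close>, on
  which \<open>\<mu>\<close> agrees (\<open>tower_measure_invariant\<close>).  It has the prescribed values on cylinders because
  some orbit segment starting in the column of \<open>x\<close> reads \<open>u\<close> exactly when \<open>x\<close> begins with the
  covering word of \<open>u\<close> (\<open>itinerary_iff_covering_word\<close>).
\<close>

section \<open>Covering words\<close>

lemma subdivision_singleton: "subdivision \<sigma> [a] = map (\<lambda>k. (a, Suc k)) [0..<length (\<sigma> [a])]"
  by (simp add: subdivision_def comp_def flip: map_Suc_upt del: upt_Suc)

lemma length_subdivision_singleton: "length (subdivision \<sigma> [a]) = length (\<sigma> [a])"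
  by (simp add: subdivision_singleton)

lemma subdivision_Nil [simp]: "subdivision \<sigma> [] = []"
  by (simp add: subdivision_def)

lemma subdivision_append: "subdivision \<sigma> (v @ w) = subdivision \<sigma> v @ subdivision \<sigma> w"
  by (simp add: subdivision_def)

lemma subdivision_Cons: "subdivision \<sigma> (a # v) = subdivision \<sigma> [a] @ subdivision \<sigma> v"
  by (simp add: subdivision_def)

lemma nth_subdivision_singleton:
  "k < length (\<sigma> [a]) \<Longrightarrow> subdivision \<sigma> [a] ! k = (a, Suc k)"
  by (simp add: subdivision_singleton)

lemma set_subdivision: "set (subdivision \<sigma> v) \<subseteq> subdivision_alphabet \<sigma>"
  by (auto simp: subdivision_def subdivision_alphabet_def)

lemma letter_map_subdivision:
  assumes "monoid_morphism \<sigma>"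
  shows "letter_map \<sigma> (subdivision \<sigma> v) = \<sigma> v"
proof (induction v)
  case Nil
  then show ?case using assms by (simp add: letter_map_def monoid_morphism_def)
next
  case (Cons a v)
  have "letter_map \<sigma> (subdivision \<sigma> [a]) = \<sigma> [a]"
    by (rule nth_equalityI)
       (auto simp: letter_map_def length_subdivision_singleton nth_subdivision_singleton)
  moreover have "\<sigma> (a # v) = \<sigma> [a] @ \<sigma> v"
    using assms unfolding monoid_morphism_def by (metis append_Cons append_Nil)
  ultimately show ?case
    using Cons by (subst subdivision_Cons) (simp add: letter_map_def)
qed

lemma length_subdivision:
  assumes "monoid_morphism \<sigma>"
  shows "length (subdivision \<sigma> v) = length (\<sigma> v)"
  using letter_map_subdivision[OF assms, of v] by (metis length_map letter_map_def)

text \<open>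
  The counterpart in the subdivision alphabet of an essential occurrence: \<open>u\<close> begins in the first
  block of \<open>\<pi>(v)\<close> and ends in the last one.
\<close>

definition essential_factor ::
    "('a list \<Rightarrow> 'b list) \<Rightarrow> 'a list \<Rightarrow> ('a \<times> nat) list \<Rightarrow> ('a \<times> nat) list \<Rightarrow> ('a \<times> nat) list \<Rightarrow> bool"
  where "essential_factor \<sigma> v p u s \<longleftrightarrow> v \<noteq> [] \<and> u \<noteq> [] \<and> subdivision \<sigma> v = p @ u @ s \<and>
     length p < length (\<sigma> [hd v]) \<and> length s < length (\<sigma> [last v])"

abbreviation block_starts :: "('a \<times> nat) list \<Rightarrow> 'a list" where
  "block_starts u \<equiv> map fst (filter (\<lambda>y. snd y = 1) u)"

text \<open>
  The first letter of \<open>u\<close> is treated apart because \<open>u\<close> may enter its first block in the middle; every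
  later block of \<open>u\<close> begins with a letter \<open>a(1)\<close>.
\<close>

definition decode :: "('a \<times> nat) list \<Rightarrow> 'a list" where
  "decode u = fst (hd u) # block_starts (tl u)"

lemma subdivision_singleton_first:
  "1 \<le> length (\<sigma> [a]) \<Longrightarrow> \<exists>t. subdivision \<sigma> [a] = (a, 1) # t \<and> (\<forall>y\<in>set t. snd y \<noteq> 1)"
  by (rule exI[of _ "map (\<lambda>k. (a, Suc k)) [1..<length (\<sigma> [a])]"])
     (auto simp: subdivision_singleton upt_rec[of 0])

lemma block_starts_subdivision:
  assumes "non_erasing \<sigma>"
  shows "block_starts (subdivision \<sigma> v) = v"
proof (induction v)
  case (Cons a v)
  obtain t where "subdivision \<sigma> [a] = (a, 1) # t" "\<forall>y\<in>set t. snd y \<noteq> 1"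
    using subdivision_singleton_first[of \<sigma> a] assms by (auto simp: non_erasing_def)
  then show ?case
    using Cons by (subst subdivision_Cons) auto
qed simp

text \<open>
  The first letter of an essential factor records its position, so different essential positions
  in \<open>\<pi>(v)\<close> carry different words.
\<close>

lemma hd_essential_factor:
  assumes "essential_factor \<sigma> v p u s"
  shows "hd u = (hd v, Suc (length p))"
proof -
  obtain a v' where v: "v = a # v'"
    using assms by (cases v) (auto simp: essential_factor_def)
  have "hd u = (p @ u @ s) ! length p"
    using assms by (auto simp: essential_factor_def hd_conv_nth nth_append)
  also have "\<dots> = (subdivision \<sigma> [a] @ subdivision \<sigma> v') ! length p"
    using assms v by (metis essential_factor_def subdivision_Cons)
  also have "\<dots> = (a, Suc (length p))"
    using assms v
    by (simp add: essential_factor_def nth_append length_subdivision_singleton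
        nth_subdivision_singleton)
  finally show ?thesis using v by simp
qed

text \<open>
  The letters \<open>a(1)\<close> of \<open>\<pi>(v)\<close> spell \<open>v\<close>.  The part after \<open>u\<close> lies strictly inside the last block and
  contributes none of them.  The part before \<open>u\<close> contributes at most the first letter of \<open>v\<close>, and it
  does so exactly when \<open>u\<close> does not itself begin with an \<open>a(1)\<close>.
\<close>

lemma essential_factor_decode:
  assumes "non_erasing \<sigma>" "essential_factor \<sigma> v p u s"
  shows "v = decode u"
proof -
  have sub: "subdivision \<sigma> v = p @ u @ s" and u: "u \<noteq> []" and v: "v \<noteq> []"
    and p: "length p < length (\<sigma> [hd v])" and s: "length s < length (\<sigma> [last v])"
    using assms(2) by (auto simp: essential_factor_def)
  have starts: "v = block_starts p @ block_starts u @ block_starts s"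
    using block_starts_subdivision[OF assms(1), of v] sub by simp
  have "block_starts s = []"
  proof -
    obtain t where t: "subdivision \<sigma> [last v] = (last v, 1) # t" "\<forall>y\<in>set t. snd y \<noteq> 1"
      using subdivision_singleton_first[of \<sigma> "last v"] assms(1) by (auto simp: non_erasing_def)
    have "subdivision \<sigma> v = subdivision \<sigma> (butlast v) @ (last v, 1) # t"
      using v t(1) by (metis append_butlast_last_id subdivision_append)
    then have "(subdivision \<sigma> (butlast v) @ [(last v, 1)]) @ t = (p @ u) @ s"
      using sub by simp
    moreover have "length s \<le> length t"
      using s t(1) length_subdivision_singleton[of \<sigma> "last v"] by simp
    ultimately have "suffix s t"
      by (metis suffixI suffix_length_suffix)
    then have "set s \<subseteq> set t" by (auto simp: suffix_def)
    then show ?thesis using t(2) by (auto simp: filter_empty_conv)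
  qed
  moreover have "block_starts p @ block_starts u = decode u"
  proof (cases p)
    case Nil
    then show ?thesis
      using hd_essential_factor[OF assms(2)] u by (cases u) (auto simp: decode_def)
  next
    case (Cons y p')
    obtain t where t: "subdivision \<sigma> [hd v] = (hd v, 1) # t" "\<forall>y\<in>set t. snd y \<noteq> 1"
      using subdivision_singleton_first[of \<sigma> "hd v"] assms(1) by (auto simp: non_erasing_def)
    have "subdivision \<sigma> v = (hd v, 1) # t @ subdivision \<sigma> (tl v)"
      using v t(1) by (metis append_Cons list.collapse subdivision_Cons)
    then have y: "y = (hd v, 1)" and "t @ subdivision \<sigma> (tl v) = p' @ u @ s"
      using sub Cons by auto
    moreover have "length p' \<le> length t"
      using p Cons t(1) length_subdivision_singleton[of \<sigma> "hd v"] by simp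
    ultimately have "prefix p' t"
      by (metis prefixI prefix_length_prefix)
    then have "set p' \<subseteq> set t" by (auto simp: prefix_def)
    then have "block_starts p' = []" using t(2) by (auto simp: filter_empty_conv)
    then show ?thesis
      using hd_essential_factor[OF assms(2)] u y Cons by (cases u) (auto simp: decode_def)
  qed
  ultimately show ?thesis using starts by simp
qed

text \<open>
  If \<open>u\<close> missed the first or the last block of \<open>\<pi>(v)\<close>, then \<open>v\<close> without its first or last letter
  would cover \<open>u\<close> as well.
\<close>

lemma essential_factor_covering_word:
  assumes "sublist u (subdivision \<sigma> v0)" "u \<noteq> []"
  obtains p s where "essential_factor \<sigma> (covering_word \<sigma> u) p u s"
proof -
  define v where "v = covering_word \<sigma> u"
  have cov: "sublist u (subdivision \<sigma> v)"
    unfolding v_def covering_word_def by (rule arg_min_natI[of _ v0]) (rule assms(1))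
  have least: "length v \<le> length v'" if "sublist u (subdivision \<sigma> v')" for v'
    unfolding v_def covering_word_def by (rule arg_min_nat_le) (rule that)
  obtain p s where ps: "subdivision \<sigma> v = p @ u @ s"
    using cov by (auto simp: sublist_def)
  have v: "v \<noteq> []" using ps assms(2) by auto
  have "length p < length (\<sigma> [hd v])"
  proof (rule ccontr)
    assume "\<not> length p < length (\<sigma> [hd v])"
    moreover have *: "subdivision \<sigma> [hd v] @ subdivision \<sigma> (tl v) = p @ u @ s"
      using ps v by (metis list.collapse subdivision_Cons)
    ultimately have "prefix (subdivision \<sigma> [hd v]) p"
      by (metis length_subdivision_singleton linorder_not_less prefixI prefix_length_prefix)
    then obtain p' where "p = subdivision \<sigma> [hd v] @ p'" by (auto simp: prefix_def)
    then have "subdivision \<sigma> (tl v) = p' @ u @ s" using * by simp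
    then have "length v \<le> length (tl v)" by (intro least) (auto simp: sublist_def)
    then show False using v by (cases v) auto
  qed
  moreover have "length s < length (\<sigma> [last v])"
  proof (rule ccontr)
    assume "\<not> length s < length (\<sigma> [last v])"
    moreover have *: "subdivision \<sigma> (butlast v) @ subdivision \<sigma> [last v] = (p @ u) @ s"
      using ps v by (metis append_butlast_last_id subdivision_append append_assoc)
    ultimately have "suffix (subdivision \<sigma> [last v]) s"
      by (metis length_subdivision_singleton linorder_not_less suffixI suffix_length_suffix)
    then obtain s' where "s = s' @ subdivision \<sigma> [last v]" by (auto simp: suffix_def)
    then have "subdivision \<sigma> (butlast v) = p @ u @ s'" using * by simp
    then have "length v \<le> length (butlast v)" by (intro least) (auto simp: sublist_def)
    then show False using v by (cases v rule: rev_cases) auto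
  qed
  ultimately show thesis
    using that v ps assms(2) unfolding essential_factor_def v_def by blast
qed

text \<open>
  This is also where shortest covering words are seen to be unique: all of them are essential for
  \<open>u\<close>, and hence equal to \<open>decode u\<close>.
\<close>

lemma covering_word_eq:
  assumes "non_erasing \<sigma>" "essential_factor \<sigma> v p u s"
  shows "covering_word \<sigma> u = v"
proof -
  have "sublist u (subdivision \<sigma> v)" "u \<noteq> []"
    using assms(2) by (auto simp: essential_factor_def sublist_def)
  then obtain p' s' where "essential_factor \<sigma> (covering_word \<sigma> u) p' u s'"
    by (rule essential_factor_covering_word)
  then show ?thesis
    using essential_factor_decode assms by metis
qed

section \<open>The Borel structure of the full shift\<close>

definition shift_space :: "(int \<Rightarrow> 'a) measure" where
  "shift_space = sigma UNIV {U. openin shift_topology U}"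

text \<open>
  Symmetric windows are nested, so two of these sets are either disjoint or comparable.  The
  cylinders \<open>[w]\<close>, which all begin at position 1, generate only the one-sided events.
\<close>

definition central_cylinder :: "nat \<Rightarrow> (int \<Rightarrow> 'a) \<Rightarrow> (int \<Rightarrow> 'a) set" where
  "central_cylinder n x = {y. \<forall>i. \<bar>i\<bar> \<le> int n \<longrightarrow> y i = x i}"

lemma space_shift_space [simp]: "space shift_space = UNIV"
  by (simp add: shift_space_def space_measure_of_conv)

lemma sets_shift_space: "sets shift_space = sigma_sets UNIV {U. openin shift_topology U}"
  by (simp add: shift_space_def)

lemma measurable_coordinate [measurable]: "(\<lambda>x. x i) \<in> measurable shift_space (count_space UNIV)"
proof (rule measurableI)
  fix B :: "'a set"
  have "continuous_map shift_topology (discrete_topology UNIV) (\<lambda>x::int \<Rightarrow> 'a. x i)"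
    unfolding shift_topology_def by (rule continuous_map_product_projection) simp
  then have "openin shift_topology {x \<in> topspace shift_topology. x i \<in> B}"
    by (rule openin_continuous_map_preimage) simp
  then show "(\<lambda>x. x i) -` B \<inter> space shift_space \<in> sets shift_space"
    by (auto simp: sets_shift_space shift_topology_def vimage_def)
qed simp

lemma countable_central_cylinders:
  "countable (range (\<lambda>(n, x::int \<Rightarrow> 'a::finite). central_cylinder n x))"
proof -
  let ?C = "\<lambda>(n, w::'a list). {y. map y [- int n..int n] = w}"
  have "central_cylinder n x = ?C (n, map x [- int n..int n])" for n and x :: "int \<Rightarrow> 'a"
    by (auto simp: central_cylinder_def abs_le_iff)
  then have "range (\<lambda>(n, x::int \<Rightarrow> 'a). central_cylinder n x) \<subseteq> range ?C"
    by (metis (no_types, lifting) case_prod_conv image_subsetI rangeI surj_pair)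
  then show ?thesis
    by (rule countable_subset) (rule countable_image, simp)
qed

text \<open>
  A basic open set of the product topology restricts finitely many coordinates, and these lie in a
  common symmetric window.
\<close>

lemma openin_shift_topology_imp_central_cylinder:
  assumes "openin shift_topology U" "x \<in> U"
  obtains n where "central_cylinder n x \<subseteq> U"
proof -
  obtain V where V: "finite {i. V i \<noteq> (UNIV :: 'a set)}" "x \<in> Pi\<^sub>E UNIV V" "Pi\<^sub>E UNIV V \<subseteq> U"
    using assms unfolding shift_topology_def openin_product_topology_alt
    by (metis (no_types, lifting) Collect_cong UNIV_I topspace_discrete_topology)
  define n where "n = nat (Max (insert 0 (abs ` {i. V i \<noteq> UNIV})))"
  have "\<bar>i\<bar> \<le> int n" if "V i \<noteq> UNIV" for i
    using that V(1) unfolding n_def by (simp add: Max_ge_iff)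
  then have "y i \<in> V i" if "y \<in> central_cylinder n x" for y i
    using V(2) that by (cases "V i = UNIV") (auto simp: central_cylinder_def)
  then have "central_cylinder n x \<subseteq> Pi\<^sub>E UNIV V" by auto
  then show thesis using V(3) by (intro that) (rule subset_trans)
qed

text \<open>
  There are countably many central cylinders over a finite alphabet, so each open set is a
  countable union of them.
\<close>

lemma sets_shift_space_central:
  "sets (shift_space :: (int \<Rightarrow> 'a::finite) measure) =
     sigma_sets UNIV (range (\<lambda>(n, x). central_cylinder n x))" (is "_ = sigma_sets UNIV ?G")
proof
  have "U \<in> sigma_sets UNIV ?G" if U: "openin shift_topology U" for U :: "(int \<Rightarrow> 'a) set"
  proof -
    have "U = \<Union> {C \<in> ?G. C \<subseteq> U}"
    proof
      show "U \<subseteq> \<Union> {C \<in> ?G. C \<subseteq> U}"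
      proof
        fix x assume "x \<in> U"
        then obtain n where "central_cylinder n x \<subseteq> U"
          using openin_shift_topology_imp_central_cylinder[OF U] by metis
        moreover have "x \<in> central_cylinder n x" by (simp add: central_cylinder_def)
        moreover have "central_cylinder n x \<in> ?G" by (rule image_eqI[of _ _ "(n, x)"]) auto
        ultimately show "x \<in> \<Union> {C \<in> ?G. C \<subseteq> U}" by (intro UnionI CollectI conjI)
      qed
    qed (rule Union_least, simp)
    moreover have "countable {C \<in> ?G. C \<subseteq> U}"
      by (rule countable_subset[OF _ countable_central_cylinders]) auto
    ultimately show ?thesis
      by (metis (mono_tags, lifting) mem_Collect_eq sigma_sets.Basic sigma_sets_UNION)
  qed
  then show "sets shift_space \<subseteq> sigma_sets UNIV ?G"
    unfolding sets_shift_space by (intro sigma_sets_mono) auto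
next
  have "central_cylinder n x \<in> sets shift_space" for n and x :: "int \<Rightarrow> 'a"
  proof -
    have "central_cylinder n x = (\<Inter>i\<in>{- int n..int n}. (\<lambda>y. y i) -` {x i} \<inter> space shift_space)"
      by (auto simp: central_cylinder_def abs_le_iff)
    also have "\<dots> \<in> sets shift_space"
      by (intro sets.finite_INT measurable_sets[OF measurable_coordinate]) auto
    finally show ?thesis .
  qed
  then have "?G \<subseteq> sets shift_space" by auto
  then show "sigma_sets UNIV ?G \<subseteq> sets shift_space"
    by (metis sets.sigma_sets_subset space_shift_space)
qed

lemma measurable_shift_space:
  fixes f :: "'c \<Rightarrow> int \<Rightarrow> 'a::finite"
  assumes "\<And>i. (\<lambda>y. f y i) \<in> measurable M (count_space UNIV)"
  shows "f \<in> measurable M shift_space"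
proof (rule measurable_sigma_sets[OF sets_shift_space_central])
  fix C assume "C \<in> range (\<lambda>(n, x::int \<Rightarrow> 'a). central_cylinder n x)"
  then obtain n x where "C = central_cylinder n x" by auto
  then have "f -` C \<inter> space M = (\<Inter>i\<in>{- int n..int n}. (\<lambda>y. f y i) -` {x i} \<inter> space M)"
    by (auto simp: central_cylinder_def abs_le_iff)
  also have "\<dots> \<in> sets M"
    by (intro sets.finite_INT measurable_sets[OF assms]) auto
  finally show "f -` C \<inter> space M \<in> sets M" .
qed simp_all

lemma measurable_shift [measurable]:
  "shift \<in> measurable shift_space (shift_space :: (int \<Rightarrow> 'a::finite) measure)"
  by (rule measurable_shift_space) (simp add: shift_def measurable_coordinate)

lemma sets_cylinder [measurable]: "cylinder (w :: 'a list) \<in> sets shift_space"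
proof -
  have "cylinder w = {x \<in> space shift_space. \<forall>j\<in>{1..int (length w)}. x j = w ! nat (j - 1)}"
    unfolding cylinder_def
  proof (intro Collect_eqI)
    fix x :: "int \<Rightarrow> 'a"
    have "map x [1..int (length w)] = w \<longleftrightarrow>
        map x [1..int (length w)] = map (\<lambda>j. w ! nat (j - 1)) [1..int (length w)]"
      by (rule arg_cong[where f = "\<lambda>v. _ = v"], rule nth_equalityI) (auto simp: nth_upto)
    then show "map x [1..int (length w)] = w \<longleftrightarrow>
        x \<in> space shift_space \<and> (\<forall>j\<in>{1..int (length w)}. x j = w ! nat (j - 1))"
      by simp
  qed
  also have "\<dots> \<in> sets shift_space" by measurable
  finally show ?thesis .
qed

lemma invariant_measures_iff:
  "\<nu> \<in> invariant_measures \<longleftrightarrow> sets \<nu> = sets shift_space \<and> finite_measure \<nu> \<and>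
     (\<forall>X\<in>sets \<nu>. emeasure \<nu> (shift -` X) = emeasure \<nu> X)"
  by (simp add: invariant_measures_def sets_shift_space)

text \<open>The window from \<open>- n\<close> to \<open>n\<close>, moved by \<open>n + 1\<close>, starts at position 1.\<close>

lemma emeasure_central_cylinder:
  fixes \<nu> :: "(int \<Rightarrow> 'a::finite) measure"
  assumes "\<nu> \<in> invariant_measures"
  shows "emeasure \<nu> (central_cylinder n x) =
    emeasure \<nu> (cylinder (map (\<lambda>j. x (j - int n - 1)) [1..2 * int n + 1]))"
proof -
  have sets: "sets \<nu> = sets shift_space"
    using assms by (simp add: invariant_measures_iff)
  have vimage: "(shift ^^ m) -` X \<in> sets \<nu>" "emeasure \<nu> ((shift ^^ m) -` X) = emeasure \<nu> X"
    if "X \<in> sets \<nu>" for m X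
  proof (induction m)
    case (Suc m)
    have eq: "(shift ^^ Suc m) -` X = shift -` ((shift ^^ m) -` X)"
      by (auto simp: funpow_swap1)
    show "(shift ^^ Suc m) -` X \<in> sets \<nu>"
      using measurable_sets[OF measurable_shift, of "(shift ^^ m) -` X"] Suc.IH(1)
      unfolding eq by (simp add: sets)
    show "emeasure \<nu> ((shift ^^ Suc m) -` X) = emeasure \<nu> X"
      using Suc.IH assms unfolding eq by (simp add: invariant_measures_iff)
  qed (use that in auto)
  have "(shift ^^ m) y i = y (i + int m)" for m i and y :: "int \<Rightarrow> 'a"
    by (induction m arbitrary: i) (auto simp: shift_def algebra_simps)
  then have "(shift ^^ (n + 1)) -` central_cylinder n x =
      {y. \<forall>i. \<bar>i\<bar> \<le> int n \<longrightarrow> y (i + int n + 1) = x i}"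
    by (simp add: central_cylinder_def vimage_def algebra_simps del: funpow.simps)
  also have "\<dots> = {y. \<forall>j. 1 \<le> j \<and> j \<le> 2 * int n + 1 \<longrightarrow> y j = x (j - int n - 1)}"
  proof (intro Collect_cong iffI allI impI)
    fix y j assume "\<forall>i. \<bar>i\<bar> \<le> int n \<longrightarrow> y (i + int n + 1) = x i" "1 \<le> j \<and> j \<le> 2 * int n + 1"
    then show "y j = x (j - int n - 1)" by (auto dest!: spec[of _ "j - int n - 1"])
  next
    fix y i assume "\<forall>j. 1 \<le> j \<and> j \<le> 2 * int n + 1 \<longrightarrow> y j = x (j - int n - 1)" "\<bar>i\<bar> \<le> int n"
    then show "y (i + int n + 1) = x i" by (auto dest!: spec[of _ "i + int n + 1"])
  qed
  also have "\<dots> = cylinder (map (\<lambda>j. x (j - int n - 1)) [1..2 * int n + 1])"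
    by (auto simp: cylinder_def)
  finally have "(shift ^^ (n + 1)) -` central_cylinder n x =
      cylinder (map (\<lambda>j. x (j - int n - 1)) [1..2 * int n + 1])" .
  moreover have "central_cylinder n x \<in> sets \<nu>"
    unfolding sets sets_shift_space_central by (rule sigma_sets.Basic) auto
  ultimately show ?thesis using vimage(2)[of "central_cylinder n x" "n + 1"] by simp
qed

lemma invariant_measure_eqI:
  fixes \<nu> \<nu>' :: "(int \<Rightarrow> 'a::finite) measure"
  assumes inv: "\<nu> \<in> invariant_measures" "\<nu>' \<in> invariant_measures"
    and eq: "\<And>w. w \<noteq> [] \<Longrightarrow> measure \<nu> (cylinder w) = measure \<nu>' (cylinder w)"
  shows "\<nu> = \<nu>'"
proof -
  let ?G = "range (\<lambda>(n, x::int \<Rightarrow> 'a). central_cylinder n x)"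
  interpret \<nu>: finite_measure \<nu> using inv by (simp add: invariant_measures_iff)
  interpret \<nu>': finite_measure \<nu>' using inv by (simp add: invariant_measures_iff)
  have central: "emeasure \<nu> (central_cylinder n x) = emeasure \<nu>' (central_cylinder n x)" for n x
    unfolding emeasure_central_cylinder[OF inv(1)] emeasure_central_cylinder[OF inv(2)]
    by (simp add: \<nu>.emeasure_eq_measure \<nu>'.emeasure_eq_measure eq)
  show ?thesis
  proof (rule measure_eqI_generator_eq_countable[where E = "insert {} ?G" and \<Omega> = UNIV and A = ?G])
    show "Int_stable (insert {} ?G)"
    proof (rule Int_stableI)
      have meet: "central_cylinder n x \<inter> central_cylinder m y \<in> insert {} ?G"
        if "n \<le> m" for n m and x y :: "int \<Rightarrow> 'a"
      proof (cases "\<forall>i. \<bar>i\<bar> \<le> int n \<longrightarrow> y i = x i")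
        case True
        then have "central_cylinder n x \<inter> central_cylinder m y = central_cylinder m y"
          using that by (auto simp: central_cylinder_def)
        then show ?thesis by auto
      next
        case False
        then obtain i where "\<bar>i\<bar> \<le> int n" "y i \<noteq> x i" by blast
        then have "central_cylinder n x \<inter> central_cylinder m y = {}"
          using that by (fastforce simp: central_cylinder_def)
        then show ?thesis by simp
      qed
      fix C D assume "C \<in> insert {} ?G" "D \<in> insert {} ?G"
      then consider "C = {} \<or> D = {}"
        | n x m y where "C = central_cylinder n x" "D = central_cylinder m y" by auto
      then show "C \<inter> D \<in> insert {} ?G"
        by cases (use meet nle_le Int_commute in \<open>metis inf_bot_left inf_bot_right insertI1\<close>)+
    qed
    have "sigma_sets UNIV (insert {} ?G) = sigma_sets UNIV ?G"
      by (intro sigma_sets_eqI) (auto intro: sigma_sets.Empty sigma_sets.Basic)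
    then show "sets \<nu> = sigma_sets UNIV (insert {} ?G)" "sets \<nu>' = sigma_sets UNIV (insert {} ?G)"
      using inv by (simp_all add: invariant_measures_iff sets_shift_space_central)
    show "\<Union> ?G = UNIV" by (auto simp: central_cylinder_def)
    show "countable ?G" by (rule countable_central_cylinders)
  qed (use central in auto)
qed

section \<open>The tower over the full shift\<close>

text \<open>
  A point \<open>(x, k)\<close> with \<open>k < |\<sigma>(x\<^sub>1)|\<close> stands for the image of \<open>x\<close> under \<open>\<sigma>\<close>, placed so that position 1
  is the letter number \<open>k + 1\<close> of the block \<open>\<sigma>(x\<^sub>1)\<close>.  The pairs that violate the bound are not part
  of the tower; their density in \<open>tower_measure\<close> is zero.
\<close>

definition tower_step :: "('a list \<Rightarrow> 'b list) \<Rightarrow> (int \<Rightarrow> 'a) \<times> nat \<Rightarrow> (int \<Rightarrow> 'a) \<times> nat" where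
  "tower_step \<sigma> y = (if Suc (snd y) < length (\<sigma> [fst y 1]) then (fst y, Suc (snd y))
     else (shift (fst y), 0))"

definition tower_back :: "('a list \<Rightarrow> 'b list) \<Rightarrow> (int \<Rightarrow> 'a) \<times> nat \<Rightarrow> (int \<Rightarrow> 'a) \<times> nat" where
  "tower_back \<sigma> y = (if snd y = 0 then (\<lambda>j. fst y (j - 1), length (\<sigma> [fst y 0]) - 1)
     else (fst y, snd y - 1))"

definition tower_orbit :: "('a list \<Rightarrow> 'b list) \<Rightarrow> (int \<Rightarrow> 'a) \<times> nat \<Rightarrow> int \<Rightarrow> (int \<Rightarrow> 'a) \<times> nat" where
  "tower_orbit \<sigma> y i =
     (if 0 \<le> i then (tower_step \<sigma> ^^ nat i) y else (tower_back \<sigma> ^^ nat (- i)) y)"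

definition tower_letter :: "(int \<Rightarrow> 'a) \<times> nat \<Rightarrow> 'a \<times> nat" where
  "tower_letter y = (fst y 1, Suc (snd y))"

text \<open>
  The coordinate at position 1 is the letter of the point itself, whence the shift of the orbit
  index by one.
\<close>

definition tower_code :: "('a list \<Rightarrow> 'b list) \<Rightarrow> (int \<Rightarrow> 'a) \<times> nat \<Rightarrow> int \<Rightarrow> 'b" where
  "tower_code \<sigma> y i = (\<lambda>(a, k). \<sigma> [a] ! (k - 1)) (tower_letter (tower_orbit \<sigma> y (i - 1)))"

definition itinerary :: "('a list \<Rightarrow> 'b list) \<Rightarrow> nat \<Rightarrow> (int \<Rightarrow> 'a) \<times> nat \<Rightarrow> ('a \<times> nat) list" where
  "itinerary \<sigma> n y = map (\<lambda>j. tower_letter ((tower_step \<sigma> ^^ j) y)) [0..<n]"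

definition tower_measure ::
    "('a list \<Rightarrow> 'b list) \<Rightarrow> (int \<Rightarrow> 'a) measure \<Rightarrow> (int \<Rightarrow> 'b) measure" where
  "tower_measure \<sigma> \<mu> =
     distr (density (\<mu> \<Otimes>\<^sub>M count_space UNIV) (\<lambda>y. indicator {..<length (\<sigma> [fst y 1])} (snd y)))
       shift_space (tower_code \<sigma>)"

lemma tower_back_step:
  assumes "k < length (\<sigma> [x 1])"
  shows "tower_back \<sigma> (tower_step \<sigma> (x, k)) = (x, k)"
  using assms by (auto simp: tower_back_def tower_step_def shift_def)

lemma tower_orbit_step:
  assumes "k < length (\<sigma> [x 1])"
  shows "tower_orbit \<sigma> (tower_step \<sigma> (x, k)) i = tower_orbit \<sigma> (x, k) (i + 1)"
proof (cases "0 \<le> i")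
  case True
  then have "nat (i + 1) = Suc (nat i)" by simp
  then show ?thesis using True by (simp add: tower_orbit_def funpow_swap1)
next
  case False
  then have "nat (- i) = Suc (nat (- (i + 1)))" by simp
  then have "tower_orbit \<sigma> (tower_step \<sigma> (x, k)) i = (tower_back \<sigma> ^^ nat (- (i + 1))) (x, k)"
    using False by (simp add: tower_orbit_def funpow_swap1 tower_back_step[of k \<sigma> x, OF assms])
  then show ?thesis using False by (auto simp: tower_orbit_def)
qed

text \<open>The coding map conjugates the step of the tower to the shift.\<close>

lemma tower_code_step:
  assumes "k < length (\<sigma> [x 1])"
  shows "tower_code \<sigma> (tower_step \<sigma> (x, k)) = shift (tower_code \<sigma> (x, k))"
  by (rule ext) (simp add: tower_code_def shift_def tower_orbit_step[of k \<sigma> x, OF assms])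

lemma upto_conv_upt: "[1..int n] = map (\<lambda>j. int j + 1) [0..<n]"
  by (rule nth_equalityI) auto

lemma tower_code_cylinder_iff:
  assumes "length w = n"
  shows "tower_code \<sigma> y \<in> cylinder w \<longleftrightarrow> letter_map \<sigma> (itinerary \<sigma> n y) = w"
  using assms
  by (simp add: cylinder_def letter_map_def itinerary_def upto_conv_upt tower_code_def
      tower_orbit_def comp_def)

lemma tower_step_funpow:
  "k < length (\<sigma> [x 1]) \<Longrightarrow> (tower_step \<sigma> ^^ k) (x, 0) = (x, k)"
  by (induction k) (auto simp: tower_step_def)

lemma tower_step_funpow_block:
  assumes "1 \<le> length (\<sigma> [x 1])"
  shows "(tower_step \<sigma> ^^ length (\<sigma> [x 1])) (x, 0) = (shift x, 0)"
proof -
  obtain k where k: "length (\<sigma> [x 1]) = Suc k" using assms by (cases "length (\<sigma> [x 1])") auto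
  then show ?thesis using tower_step_funpow[of k \<sigma> x] by (simp add: tower_step_def)
qed

lemma length_itinerary [simp]: "length (itinerary \<sigma> n y) = n"
  by (simp add: itinerary_def)

lemma itinerary_add:
  "itinerary \<sigma> (m + n) y = itinerary \<sigma> m y @ itinerary \<sigma> n ((tower_step \<sigma> ^^ m) y)"
  by (rule nth_equalityI)
     (auto simp: itinerary_def nth_append simp flip: funpow_add[THEN fun_cong, unfolded comp_apply])

lemma itinerary_block:
  "itinerary \<sigma> (length (\<sigma> [x 1])) (x, 0) = subdivision \<sigma> [x 1]"
  by (rule nth_equalityI)
     (auto simp: itinerary_def length_subdivision_singleton nth_subdivision_singleton
        tower_step_funpow tower_letter_def)

text \<open>
  Starting at the bottom of a column, the orbit runs through whole blocks, so the tower spells the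
  subdivision of \<open>x\<close>.
\<close>

lemma itinerary_subdivision:
  assumes "non_erasing \<sigma>"
  shows "itinerary \<sigma> (length (subdivision \<sigma> (map x [1..int m]))) (x, 0) =
    subdivision \<sigma> (map x [1..int m])"
proof (induction m arbitrary: x)
  case (Suc m)
  have pos: "1 \<le> length (\<sigma> [x 1])" using assms by (simp add: non_erasing_def)
  have "map x [1..int (Suc m)] = x 1 # map (shift x) [1..int m]"
    by (rule nth_equalityI)
       (auto simp: nth_Cons shift_def upto_conv_upt add.commute split: nat.split simp del: upt_Suc)
  then have "subdivision \<sigma> (map x [1..int (Suc m)]) =
      subdivision \<sigma> [x 1] @ subdivision \<sigma> (map (shift x) [1..int m])"
    by (metis subdivision_Cons)
  then show ?case
    using Suc.IH[of "shift x"]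
    by (simp add: itinerary_add length_subdivision_singleton itinerary_block
        tower_step_funpow_block[of \<sigma> x, OF pos] del: of_nat_Suc)
qed (simp add: itinerary_def)

lemma itinerary_infix:
  assumes "non_erasing \<sigma>" "subdivision \<sigma> (map x [1..int m]) = p @ u @ s"
    and "length p < length (\<sigma> [x 1])"
  shows "itinerary \<sigma> (length u) (x, length p) = u"
proof -
  have "itinerary \<sigma> (length p + (length u + length s)) (x, 0) = p @ u @ s"
    using itinerary_subdivision[OF assms(1), of x m] assms(2) by simp
  then show ?thesis
    using tower_step_funpow[of "length p" \<sigma> x] assms(3) by (simp add: itinerary_add)
qed

lemma length_subdivision_ge:
  assumes "non_erasing \<sigma>"
  shows "length v \<le> length (subdivision \<sigma> v)"
proof (induction v)
  case (Cons a v)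
  have "1 \<le> length (\<sigma> [a])" using assms by (simp add: non_erasing_def)
  then show ?case
    using Cons by (subst subdivision_Cons) (simp add: length_subdivision_singleton)
qed simp

text \<open>
  This links the tower with covering words.  An itinerary from level \<open>k\<close> is a factor of
  \<open>\<pi>(x\<^sub>1 \<dots> x\<^sub>m)\<close> as soon as \<open>m\<close> is large enough; for the least such \<open>m\<close> it also ends in the last
  block, so it is essential and \<open>x\<^sub>1 \<dots> x\<^sub>m\<close> is its covering word.  Conversely, if \<open>x\<close> begins with the
  covering word, then \<open>u\<close> is read from the level at which it enters the first block.
\<close>

lemma itinerary_iff_covering_word:
  assumes ne: "non_erasing \<sigma>" and u: "u \<noteq> []"
  shows "(\<exists>k<length (\<sigma> [x 1]). itinerary \<sigma> (length u) (x, k) = u) \<longleftrightarrow>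
    (\<exists>v. sublist u (subdivision \<sigma> v)) \<and> x \<in> cylinder (covering_word \<sigma> u)"
proof
  assume "\<exists>k<length (\<sigma> [x 1]). itinerary \<sigma> (length u) (x, k) = u"
  then obtain k where k: "k < length (\<sigma> [x 1])" "itinerary \<sigma> (length u) (x, k) = u" by blast
  let ?\<pi> = "\<lambda>m. subdivision \<sigma> (map x [1..int m])"
  define m where "m = (LEAST m. k + length u \<le> length (?\<pi> m))"
  have ex: "k + length u \<le> length (?\<pi> (k + length u))"
    using length_subdivision_ge[OF ne, of "map x [1..int (k + length u)]"] by simp
  have m: "k + length u \<le> length (?\<pi> m)"
    unfolding m_def by (rule LeastI) (rule ex)
  then have "m \<noteq> 0" using u by (intro notI) simp
  then obtain m' where m': "m = Suc m'" by (cases m) auto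
  have less: "length (?\<pi> m') < k + length u"
    using not_less_Least[of m' "\<lambda>m. k + length u \<le> length (?\<pi> m)"] m' unfolding m_def by simp
  have snoc: "map x [1..int m] = map x [1..int m'] @ [x (int m)]"
    using m' by (simp add: upto_conv_upt add.commute del: of_nat_Suc) (simp add: add.commute)
  define s where "s = drop (k + length u) (?\<pi> m)"
  have "?\<pi> m = itinerary \<sigma> (k + length u + (length (?\<pi> m) - (k + length u))) (x, 0)"
    using itinerary_subdivision[OF ne, of x m] m by simp
  also have "\<dots> = itinerary \<sigma> k (x, 0) @ u @
      itinerary \<sigma> (length (?\<pi> m) - (k + length u)) ((tower_step \<sigma> ^^ (k + length u)) (x, 0))"
    using k by (simp only: itinerary_add tower_step_funpow append_assoc)
  finally have split: "?\<pi> m = itinerary \<sigma> k (x, 0) @ u @ s"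
    by (metis append_assoc append_eq_conv_conj length_append length_itinerary s_def)
  have "length s < length (\<sigma> [x (int m)])"
    using less m unfolding s_def
    by (simp add: snoc subdivision_append length_subdivision_singleton)
  moreover have "hd (map x [1..int m]) = x 1" using m' by (simp add: upto_rec1)
  ultimately have ess: "essential_factor \<sigma> (map x [1..int m]) (itinerary \<sigma> k (x, 0)) u s"
    using split u k m' snoc by (simp add: essential_factor_def)
  have "covering_word \<sigma> u = map x [1..int m]" by (rule covering_word_eq[OF ne ess])
  then show "(\<exists>v. sublist u (subdivision \<sigma> v)) \<and> x \<in> cylinder (covering_word \<sigma> u)"
    using split by (auto simp: cylinder_def sublist_def)
next
  assume "(\<exists>v. sublist u (subdivision \<sigma> v)) \<and> x \<in> cylinder (covering_word \<sigma> u)"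
  then obtain v0 where "sublist u (subdivision \<sigma> v0)"
    and x: "map x [1..int (length (covering_word \<sigma> u))] = covering_word \<sigma> u"
    by (auto simp: cylinder_def)
  then obtain p s where ess: "essential_factor \<sigma> (covering_word \<sigma> u) p u s"
    using essential_factor_covering_word u by metis
  have "hd (covering_word \<sigma> u) = x 1"
    using x ess by (cases "covering_word \<sigma> u")
      (auto simp: essential_factor_def upto_rec1)
  then show "\<exists>k<length (\<sigma> [x 1]). itinerary \<sigma> (length u) (x, k) = u"
    using itinerary_infix[OF ne, of x "length (covering_word \<sigma> u)" p u s] ess x
    by (auto simp: essential_factor_def)
qed

section \<open>The measure of the tower\<close>

lemma measurable_tower_step:
  "tower_step \<sigma> \<in> measurable (shift_space \<Otimes>\<^sub>M count_space UNIV)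
     ((shift_space :: (int \<Rightarrow> 'a::finite) measure) \<Otimes>\<^sub>M count_space UNIV)"
proof -
  have [measurable]: "(\<lambda>y::(int \<Rightarrow> 'a) \<times> nat. length (\<sigma> [fst y 1])) \<in>
      measurable (shift_space \<Otimes>\<^sub>M count_space UNIV) (count_space UNIV)"
    by (rule measurable_compose[OF measurable_fst])
       (rule measurable_compose[OF measurable_coordinate], simp)
  show ?thesis unfolding tower_step_def[abs_def] by measurable
qed

lemma measurable_tower_back:
  "tower_back \<sigma> \<in> measurable (shift_space \<Otimes>\<^sub>M count_space UNIV)
     ((shift_space :: (int \<Rightarrow> 'a::finite) measure) \<Otimes>\<^sub>M count_space UNIV)"
proof -
  have [measurable]: "(\<lambda>y::(int \<Rightarrow> 'a) \<times> nat. length (\<sigma> [fst y 0]) - 1) \<in>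
      measurable (shift_space \<Otimes>\<^sub>M count_space UNIV) (count_space UNIV)"
    by (rule measurable_compose[OF measurable_fst])
       (rule measurable_compose[OF measurable_coordinate], simp)
  have [measurable]: "(\<lambda>x j. x (j - 1)) \<in>
      measurable shift_space (shift_space :: (int \<Rightarrow> 'a) measure)"
    by (rule measurable_shift_space) (rule measurable_coordinate)
  show ?thesis unfolding tower_back_def[abs_def] by measurable
qed

lemma measurable_tower_code:
  fixes \<sigma> :: "'a::finite list \<Rightarrow> 'b::finite list"
  shows "tower_code \<sigma> \<in> measurable (shift_space \<Otimes>\<^sub>M count_space UNIV) shift_space"
proof (rule measurable_shift_space)
  fix i
  let ?Y = "(shift_space :: (int \<Rightarrow> 'a) measure) \<Otimes>\<^sub>M count_space (UNIV :: nat set)"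
  have orbit: "(\<lambda>y. tower_orbit \<sigma> y (i - 1)) \<in> measurable ?Y ?Y"
    unfolding tower_orbit_def
    by (cases "0 \<le> i - 1")
       (simp_all add: measurable_compose_n measurable_tower_step measurable_tower_back)
  have letter: "tower_letter \<in> measurable ?Y (count_space UNIV)"
    unfolding tower_letter_def[abs_def]
    using measurable_compose[OF measurable_fst measurable_coordinate[of 1]]
    by measurable
  show "(\<lambda>y. tower_code \<sigma> y i) \<in> measurable ?Y (count_space UNIV)"
    unfolding tower_code_def
    by (rule measurable_compose[OF measurable_compose[OF orbit letter]]) simp
qed

lemma nn_integral_tower_measure:
  fixes \<sigma> :: "'a::finite list \<Rightarrow> 'b::finite list"
  assumes [measurable_cong]: "sets \<mu> = sets shift_space"
    and f [measurable]: "f \<in> borel_measurable shift_space"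
  shows "(\<integral>\<^sup>+z. f z \<partial>tower_measure \<sigma> \<mu>) =
    (\<integral>\<^sup>+x. (\<Sum>k<length (\<sigma> [x 1]). f (tower_code \<sigma> (x, k))) \<partial>\<mu>)"
proof -
  let ?P = "\<mu> \<Otimes>\<^sub>M count_space (UNIV :: nat set)"
  let ?d = "\<lambda>y::(int \<Rightarrow> 'a) \<times> nat. indicator {..<length (\<sigma> [fst y 1])} (snd y) :: ennreal"
  have sets: "sets ?P = sets (shift_space \<Otimes>\<^sub>M count_space UNIV)"
    by (rule sets_pair_measure_cong) (use assms in auto)
  have code [measurable]: "tower_code \<sigma> \<in> measurable ?P shift_space"
    using measurable_tower_code[of \<sigma>] measurable_cong_sets[OF sets refl] by metis
  have [measurable]: "(\<lambda>x. length (\<sigma> [x 1])) \<in> measurable \<mu> (count_space UNIV)"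
    using measurable_compose[OF measurable_coordinate[of 1], of "\<lambda>a. length (\<sigma> [a])" "count_space UNIV"]
      measurable_cong_sets[OF assms(1) refl] by (metis UNIV_I measurable_count_space_eq1 Pi_I space_count_space)
  have d [measurable]: "?d \<in> borel_measurable ?P"
    unfolding indicator_def lessThan_iff by measurable
  have "(\<integral>\<^sup>+z. f z \<partial>tower_measure \<sigma> \<mu>) = (\<integral>\<^sup>+y. ?d y * f (tower_code \<sigma> y) \<partial>?P)"
    unfolding tower_measure_def by (subst nn_integral_distr) (auto simp: nn_integral_density)
  also have "\<dots> = (\<integral>\<^sup>+x. \<integral>\<^sup>+k. ?d (x, k) * f (tower_code \<sigma> (x, k)) \<partial>count_space UNIV \<partial>\<mu>)"
    by (rule sigma_finite_measure.nn_integral_fst[symmetric])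
       (auto intro!: sigma_finite_measure_count_space)
  also have "\<dots> = (\<integral>\<^sup>+x. (\<Sum>k<length (\<sigma> [x 1]). f (tower_code \<sigma> (x, k))) \<partial>\<mu>)"
  proof (rule nn_integral_cong)
    fix x
    have "(\<integral>\<^sup>+k. ?d (x, k) * f (tower_code \<sigma> (x, k)) \<partial>count_space UNIV) =
        (\<Sum>k<length (\<sigma> [x 1]). ?d (x, k) * f (tower_code \<sigma> (x, k)))"
      by (rule nn_integral_count_space') auto
    then show "(\<integral>\<^sup>+k. ?d (x, k) * f (tower_code \<sigma> (x, k)) \<partial>count_space UNIV) =
        (\<Sum>k<length (\<sigma> [x 1]). f (tower_code \<sigma> (x, k)))"
      by simp
  qed
  finally show ?thesis .
qed

lemma measurable_sum_over_block:
  fixes F :: "nat \<Rightarrow> (int \<Rightarrow> 'a::finite) \<Rightarrow> ennreal"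
  assumes "sets \<mu> = sets shift_space" "\<And>k. F k \<in> borel_measurable \<mu>"
  shows "(\<lambda>x. \<Sum>k<length (\<sigma> [x 1]). F k x) \<in> borel_measurable \<mu>"
proof (rule measurable_compose_countable
    [where f = "\<lambda>a x. \<Sum>k<length (\<sigma> [a]). F k x" and g = "\<lambda>x. x 1"])
  show "(\<lambda>x. x 1) \<in> measurable \<mu> (count_space UNIV)"
    using measurable_coordinate measurable_cong_sets[OF assms(1) refl] by blast
qed (use assms(2) in auto)

text \<open>
  Shifting moves each level of the column over \<open>x\<close> one up and the top level to the bottom of the next
  column, so the column sum over \<open>x\<close> loses its term at \<open>(x, 0)\<close> and gains one at \<open>(T x, 0)\<close>.
  These two have the same integral because \<open>\<mu>\<close> is invariant, and they cancel because it is finite.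
\<close>

lemma tower_measure_invariant:
  fixes \<sigma> :: "'a::finite list \<Rightarrow> 'b::finite list"
  assumes ne: "non_erasing \<sigma>" and \<mu>: "\<mu> \<in> invariant_measures"
  shows "tower_measure \<sigma> \<mu> \<in> invariant_measures"
proof -
  have sets [measurable_cong]: "sets \<mu> = sets shift_space"
    using \<mu> by (simp add: invariant_measures_iff)
  have space: "space \<mu> = UNIV" using sets_eq_imp_space_eq[OF sets] by simp
  interpret finite_measure \<mu> using \<mu> by (simp add: invariant_measures_iff)
  let ?\<nu> = "tower_measure \<sigma> \<mu>"
  have sets_\<nu>: "sets ?\<nu> = sets shift_space" by (simp add: tower_measure_def)
  have space_\<nu>: "space ?\<nu> = UNIV" using sets_eq_imp_space_eq[OF sets_\<nu>] by simp
  have [measurable]: "(\<lambda>x. tower_code \<sigma> (x, k)) \<in> measurable \<mu> shift_space" for k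
    by (rule measurable_compose[OF _ measurable_tower_code]) measurable
  have [measurable]: "shift \<in> measurable \<mu> \<mu>"
    using measurable_shift measurable_cong_sets[OF sets sets] by blast

  have finite: "emeasure ?\<nu> UNIV \<noteq> \<infinity>"
  proof -
    define K where "K = Max (range (\<lambda>a. length (\<sigma> [a])))"
    have "emeasure ?\<nu> UNIV = (\<integral>\<^sup>+z. 1 \<partial>?\<nu>)" using space_\<nu> by simp
    also have "\<dots> = (\<integral>\<^sup>+x. of_nat (length (\<sigma> [x 1])) \<partial>\<mu>)"
      by (subst nn_integral_tower_measure[OF sets]) auto
    also have "\<dots> \<le> (\<integral>\<^sup>+x. of_nat K \<partial>\<mu>)"
      by (intro nn_integral_mono) (auto simp: K_def)
    also have "\<dots> < \<infinity>" by (simp add: ennreal_mult_less_top emeasure_eq_measure of_nat_less_top)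
    finally show ?thesis by simp
  qed

  have "emeasure ?\<nu> (shift -` X) = emeasure ?\<nu> X" if "X \<in> sets ?\<nu>" for X
  proof -
    have X [measurable]: "X \<in> sets shift_space" using that sets_\<nu> by simp
    have vX [measurable]: "shift -` X \<in> sets shift_space"
      using measurable_sets[OF measurable_shift X] by simp
    define g :: "nat \<Rightarrow> (int \<Rightarrow> 'a) \<Rightarrow> ennreal" where "g k x = indicator X (tower_code \<sigma> (x, k))" for k x
    define h :: "nat \<Rightarrow> (int \<Rightarrow> 'a) \<Rightarrow> ennreal" where "h k x = indicator (shift -` X) (tower_code \<sigma> (x, k))" for k x
    have [measurable]: "g k \<in> borel_measurable \<mu>" "h k \<in> borel_measurable \<mu>" for k
      unfolding g_def[abs_def] h_def[abs_def] by measurable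
    have emeasure_g: "emeasure ?\<nu> X = (\<integral>\<^sup>+x. (\<Sum>k<length (\<sigma> [x 1]). g k x) \<partial>\<mu>)"
      using nn_integral_tower_measure[OF sets, of "indicator X" \<sigma>] that by (simp add: g_def)
    have emeasure_h: "emeasure ?\<nu> (shift -` X) = (\<integral>\<^sup>+x. (\<Sum>k<length (\<sigma> [x 1]). h k x) \<partial>\<mu>)"
      using nn_integral_tower_measure[OF sets, of "indicator (shift -` X)" \<sigma>] vX sets_\<nu>
      by (simp add: h_def)
    have meas_g: "(\<lambda>x. \<Sum>k<length (\<sigma> [x 1]). g k x) \<in> borel_measurable \<mu>"
      and meas_h: "(\<lambda>x. \<Sum>k<length (\<sigma> [x 1]). h k x) \<in> borel_measurable \<mu>"
      by (rule measurable_sum_over_block[OF sets], measurable)+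
    have "g 0 x + (\<Sum>k<length (\<sigma> [x 1]). h k x) = g 0 (shift x) + (\<Sum>k<length (\<sigma> [x 1]). g k x)" for x
    proof -
      obtain m where m: "length (\<sigma> [x 1]) = Suc m"
        using ne Suc_le_D[of 0 "length (\<sigma> [x 1])"] by (auto simp: non_erasing_def)
      have h: "h k x = indicator X (tower_code \<sigma> (tower_step \<sigma> (x, k)))" if "k < Suc m" for k
        using tower_code_step[of k \<sigma> x] that m by (simp add: h_def indicator_def)
      have "(\<Sum>k<m. h k x) = (\<Sum>k<m. g (Suc k) x)"
        by (rule sum.cong) (auto simp: h g_def tower_step_def m)
      moreover have "h m x = g 0 (shift x)"
        by (simp add: h g_def tower_step_def m)
      ultimately show ?thesis
        by (simp only: m sum.lessThan_Suc[of "\<lambda>k. h k x"] sum.lessThan_Suc_shift[of "\<lambda>k. g k x"] add_ac)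
    qed
    then have "(\<integral>\<^sup>+x. g 0 x + (\<Sum>k<length (\<sigma> [x 1]). h k x) \<partial>\<mu>) =
        (\<integral>\<^sup>+x. g 0 (shift x) + (\<Sum>k<length (\<sigma> [x 1]). g k x) \<partial>\<mu>)"
      by (simp only:)
    then have "(\<integral>\<^sup>+x. g 0 x \<partial>\<mu>) + (\<integral>\<^sup>+x. (\<Sum>k<length (\<sigma> [x 1]). h k x) \<partial>\<mu>) =
        (\<integral>\<^sup>+x. g 0 (shift x) \<partial>\<mu>) + (\<integral>\<^sup>+x. (\<Sum>k<length (\<sigma> [x 1]). g k x) \<partial>\<mu>)"
      by (subst (asm) (1 2) nn_integral_add) (use meas_g meas_h in measurable)
    moreover have "(\<integral>\<^sup>+x. g 0 (shift x) \<partial>\<mu>) = (\<integral>\<^sup>+x. g 0 x \<partial>\<mu>)"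
    proof -
      have "distr \<mu> \<mu> shift = \<mu>"
        using \<mu> space by (intro measure_eqI) (auto simp: emeasure_distr invariant_measures_iff)
      moreover have "(\<integral>\<^sup>+x. g 0 x \<partial>distr \<mu> \<mu> shift) = (\<integral>\<^sup>+x. g 0 (shift x) \<partial>\<mu>)"
        by (rule nn_integral_distr) measurable
      ultimately show ?thesis by simp
    qed
    moreover have "(\<integral>\<^sup>+x. g 0 x \<partial>\<mu>) \<noteq> \<infinity>"
    proof -
      have "(\<integral>\<^sup>+x. g 0 x \<partial>\<mu>) \<le> (\<integral>\<^sup>+x. 1 \<partial>\<mu>)"
        by (intro nn_integral_mono) (simp add: g_def indicator_def)
      also have "\<dots> = ennreal (measure \<mu> (space \<mu>))" by (simp add: emeasure_eq_measure)
      also have "\<dots> < \<infinity>" by simp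
      finally show ?thesis by simp
    qed
    moreover have cancel: "a = b" if "c + a = d + b" "d = c" "c \<noteq> \<infinity>" for a b c d :: ennreal
      using that by (simp add: ennreal_add_left_cancel)
    ultimately show ?thesis
      unfolding emeasure_g emeasure_h by - (rule cancel)
  qed
  moreover have fin: "finite_measure ?\<nu>"
    by (rule finite_measureI) (simp only: space_\<nu> finite not_False_eq_True)
  ultimately show ?thesis
    unfolding invariant_measures_iff by (intro conjI ballI sets_\<nu> fin)
qed

lemma finite_letter_map_fibre:
  fixes \<sigma> :: "'a::finite list \<Rightarrow> 'b list"
  shows "finite {u \<in> lists (subdivision_alphabet \<sigma>). letter_map \<sigma> u = w}"
proof (rule finite_subset)
  have "subdivision_alphabet \<sigma> \<subseteq> (\<Union>a. {a} \<times> {..length (\<sigma> [a])})"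
    by (auto simp: subdivision_alphabet_def)
  then have "finite (subdivision_alphabet \<sigma>)" by (rule finite_subset) simp
  then show "finite {u. set u \<subseteq> subdivision_alphabet \<sigma> \<and> length u = length w}"
    by (rule finite_lists_length_eq)
qed (auto simp: letter_map_def)

text \<open>
  The levels of the column over \<open>x\<close> whose code lies in \<open>[w]\<close> have different itineraries, since an
  itinerary begins with the number of its level.  So they can be counted by the words \<open>u\<close> over \<open>w\<close>
  that are read in this column, which are those whose covering word is a prefix of \<open>x\<close>.
\<close>

lemma measure_tower_measure_cylinder:
  fixes \<sigma> :: "'a::finite list \<Rightarrow> 'b::finite list"
  assumes ne: "non_erasing \<sigma>" and \<mu>: "\<mu> \<in> invariant_measures" and w: "w \<noteq> []"
  shows "measure (tower_measure \<sigma> \<mu>) (cylinder w) =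
    (\<Sum>u\<in>{u \<in> lists (subdivision_alphabet \<sigma>). letter_map \<sigma> u = w}. covering_measure \<sigma> \<mu> u)"
    (is "_ = sum _ ?F")
proof -
  have sets [measurable_cong]: "sets \<mu> = sets shift_space"
    using \<mu> by (simp add: invariant_measures_iff)
  interpret finite_measure \<mu> using \<mu> by (simp add: invariant_measures_iff)
  let ?\<nu> = "tower_measure \<sigma> \<mu>"
  let ?it = "\<lambda>x k. itinerary \<sigma> (length w) (x, k)"
  let ?cov = "\<lambda>u. \<exists>v. sublist u (subdivision \<sigma> v)"
  have cyl: "cylinder v \<in> sets \<mu>" for v using sets_cylinder sets by blast
  have card_eq: "card {k \<in> {..<length (\<sigma> [x 1])}. letter_map \<sigma> (?it x k) = w} =
      card {u \<in> ?F. ?cov u \<and> x \<in> cylinder (covering_word \<sigma> u)}" for x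
  proof -
    let ?K = "{k \<in> {..<length (\<sigma> [x 1])}. letter_map \<sigma> (?it x k) = w}"
    have "hd (?it x k) = (x 1, Suc k)" for k
      using w by (simp add: itinerary_def hd_map tower_letter_def)
    then have "inj_on (?it x) ?K" by (intro inj_onI) (metis Pair_inject nat.inject)
    moreover have "?it x ` ?K = {u \<in> ?F. ?cov u \<and> x \<in> cylinder (covering_word \<sigma> u)}"
    proof -
      have iff: "u \<in> ?it x ` {..<length (\<sigma> [x 1])} \<longleftrightarrow> ?cov u \<and> x \<in> cylinder (covering_word \<sigma> u)"
        if "length u = length w" for u
      proof -
        have "u \<noteq> []" using that w by auto
        then show ?thesis
          using itinerary_iff_covering_word[OF ne, of u x] that by (auto simp: image_iff)
      qed
      have alphabet: "u \<in> lists (subdivision_alphabet \<sigma>)" if cov: "?cov u" for u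
      proof -
        obtain v where "set u \<subseteq> set (subdivision \<sigma> v)" using cov set_mono_sublist by blast
        then show ?thesis using set_subdivision[of \<sigma> v] by auto
      qed
      show ?thesis
      proof (rule set_eqI)
        fix u
        have "u \<in> ?it x ` ?K \<longleftrightarrow> letter_map \<sigma> u = w \<and> u \<in> ?it x ` {..<length (\<sigma> [x 1])}"
          by auto
        also have "\<dots> \<longleftrightarrow> letter_map \<sigma> u = w \<and> ?cov u \<and> x \<in> cylinder (covering_word \<sigma> u)"
        proof (rule conj_cong[OF refl])
          assume "letter_map \<sigma> u = w"
          then have "length u = length w" by (auto simp: letter_map_def)
          then show "u \<in> ?it x ` {..<length (\<sigma> [x 1])} \<longleftrightarrow>
              ?cov u \<and> x \<in> cylinder (covering_word \<sigma> u)"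
            by (rule iff)
        qed
        also have "\<dots> \<longleftrightarrow> u \<in> {u \<in> ?F. ?cov u \<and> x \<in> cylinder (covering_word \<sigma> u)}"
          using alphabet[of u] by (simp only: mem_Collect_eq) argo
        finally show "u \<in> ?it x ` ?K \<longleftrightarrow>
            u \<in> {u \<in> ?F. ?cov u \<and> x \<in> cylinder (covering_word \<sigma> u)}" .
      qed
    qed
    ultimately show ?thesis by (metis (no_types, lifting) card_image)
  qed
  have "emeasure ?\<nu> (cylinder w) = (\<integral>\<^sup>+z. indicator (cylinder w) z \<partial>?\<nu>)"
    by (simp add: tower_measure_def)
  also have "\<dots> = (\<integral>\<^sup>+x. (\<Sum>k<length (\<sigma> [x 1]). indicator (cylinder w) (tower_code \<sigma> (x, k))) \<partial>\<mu>)"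
    by (rule nn_integral_tower_measure[OF sets]) measurable
  also have "\<dots> = (\<integral>\<^sup>+x. (\<Sum>u\<in>{u \<in> ?F. ?cov u}. indicator (cylinder (covering_word \<sigma> u)) x) \<partial>\<mu>)"
  proof (rule nn_integral_cong)
    fix x
    have "(\<Sum>k<length (\<sigma> [x 1]). indicator (cylinder w) (tower_code \<sigma> (x, k)) :: ennreal) =
        of_nat (card {k \<in> {..<length (\<sigma> [x 1])}. letter_map \<sigma> (?it x k) = w})"
      by (simp add: indicator_def tower_code_cylinder_iff sum.If_cases Int_def)
    also have "\<dots> = (\<Sum>u\<in>{u \<in> ?F. ?cov u}. indicator (cylinder (covering_word \<sigma> u)) x)"
    proof -
      define T where "T = {u \<in> ?F. ?cov u}"
      have "finite T"
        unfolding T_def by (rule finite_subset[OF Collect_restrict finite_letter_map_fibre])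
      moreover have "{u \<in> ?F. ?cov u \<and> x \<in> cylinder (covering_word \<sigma> u)} =
          {u \<in> T. x \<in> cylinder (covering_word \<sigma> u)}"
        unfolding T_def by (simp only: mem_Collect_eq conj_assoc)
      ultimately show ?thesis
        unfolding card_eq T_def[symmetric] by (simp add: indicator_def Int_def)
    qed
    finally show "(\<Sum>k<length (\<sigma> [x 1]). indicator (cylinder w) (tower_code \<sigma> (x, k)) :: ennreal) =
        (\<Sum>u\<in>{u \<in> ?F. ?cov u}. indicator (cylinder (covering_word \<sigma> u)) x)" .
  qed
  also have "\<dots> = (\<Sum>u\<in>{u \<in> ?F. ?cov u}. emeasure \<mu> (cylinder (covering_word \<sigma> u)))"
    using cyl by (subst nn_integral_sum) auto
  also have "\<dots> = (\<Sum>u\<in>{u \<in> ?F. ?cov u}. ennreal (covering_measure \<sigma> \<mu> u))"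
    by (intro sum.cong) (auto simp: covering_measure_def emeasure_eq_measure)
  also have "\<dots> = ennreal (\<Sum>u\<in>{u \<in> ?F. ?cov u}. covering_measure \<sigma> \<mu> u)"
    by (intro sum_ennreal) (simp add: covering_measure_def)
  also have "(\<Sum>u\<in>{u \<in> ?F. ?cov u}. covering_measure \<sigma> \<mu> u) = (\<Sum>u\<in>?F. covering_measure \<sigma> \<mu> u)"
    by (rule sum.mono_neutral_left) (use finite_letter_map_fibre in \<open>auto simp: covering_measure_def\<close>)
  finally show ?thesis
    unfolding measure_def by (simp add: sum_nonneg covering_measure_def)
qed

lemma transfer_eq_tower_measure:
  fixes \<sigma> :: "'a::finite list \<Rightarrow> 'b::finite list"
  assumes ne: "non_erasing \<sigma>" and \<mu>: "\<mu> \<in> invariant_measures"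
  shows "transfer \<sigma> \<mu> = tower_measure \<sigma> \<mu>"
proof -
  note inv = tower_measure_invariant[OF assms] and cyl = measure_tower_measure_cylinder[OF assms]
  show ?thesis
    unfolding transfer_def
  proof (rule the_equality, goal_cases)
    case 1
    show ?case by (intro conjI allI impI inv cyl)
  next
    case (2 \<nu>)
    show ?case
    proof (rule invariant_measure_eqI)
      show "\<nu> \<in> invariant_measures" using 2 by (rule conjunct1)
      show "tower_measure \<sigma> \<mu> \<in> invariant_measures" by (rule inv)
      show "measure \<nu> (cylinder w) = measure (tower_measure \<sigma> \<mu>) (cylinder w)" if "w \<noteq> []" for w
        unfolding cyl[OF that] by (rule conjunct2[OF 2, rule_format, OF that])
    qed
  qed
qed

section \<open>Counting essential occurrences\<close>

text \<open>
  The occurrence with prefix \<open>p\<close> corresponds to the word that stands at the same place in the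
  subdivision of \<open>w\<close>.
\<close>

lemma essential_occurrences_eq_card:
  assumes mor: "monoid_morphism \<sigma>" and ne: "non_erasing \<sigma>" and w': "w' \<noteq> []"
  shows "essential_occurrences \<sigma> w w' =
    card {u. letter_map \<sigma> u = w' \<and> (\<exists>v. sublist u (subdivision \<sigma> v)) \<and> covering_word \<sigma> u = w}"
    (is "_ = card ?U")
proof (cases "w = []")
  case True
  have "covering_word \<sigma> u \<noteq> []" if u: "letter_map \<sigma> u = w'" "sublist u (subdivision \<sigma> v)" for u v
  proof -
    have "u \<noteq> []" using u(1) w' by (auto simp: letter_map_def)
    then show ?thesis
      using essential_factor_covering_word[OF u(2)] by (metis essential_factor_def)
  qed
  then have "?U = {}" using True by blast
  then have "card ?U = 0" by (simp only: card.empty)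
  moreover have "essential_occurrences \<sigma> w w' = 0" using True by (simp add: essential_occurrences_def)
  ultimately show ?thesis by (simp only:)
next
  case False
  let ?\<pi> = "subdivision \<sigma> w"
  let ?E = "{(p, s). \<sigma> w = p @ w' @ s \<and> length p < length (\<sigma> [hd w]) \<and> length s < length (\<sigma> [last w])}"
  define g where "g = (\<lambda>(p :: 'b list, s :: 'b list). take (length w') (drop (length p) ?\<pi>))"
  have g: "essential_factor \<sigma> w (take (length p) ?\<pi>) (g (p, s)) (drop (length p + length w') ?\<pi>)"
    "letter_map \<sigma> (g (p, s)) = w'" if "(p, s) \<in> ?E" for p s
  proof -
    have eq: "letter_map \<sigma> ?\<pi> = p @ w' @ s"
      using that letter_map_subdivision[OF mor, of w] by simp
    then have len: "length ?\<pi> = length p + length w' + length s"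
      by (metis add.assoc length_append length_map letter_map_def)
    have "letter_map \<sigma> (g (p, s)) = take (length w') (drop (length p) (letter_map \<sigma> ?\<pi>))"
      by (simp add: g_def letter_map_def take_map drop_map)
    then show "letter_map \<sigma> (g (p, s)) = w'" using eq by simp
    have "?\<pi> = take (length p) ?\<pi> @ g (p, s) @ drop (length p + length w') ?\<pi>"
      unfolding g_def by (metis add.commute append_take_drop_id case_prod_conv drop_drop)
    moreover have "g (p, s) \<noteq> []" using len w' by (simp add: g_def)
    ultimately show "essential_factor \<sigma> w (take (length p) ?\<pi>) (g (p, s)) (drop (length p + length w') ?\<pi>)"
      using that len False by (simp add: essential_factor_def)
  qed
  have "inj_on g ?E"
  proof (rule inj_onI)
    fix e e' assume e: "e \<in> ?E" "e' \<in> ?E" "g e = g e'"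
    obtain p s p' s' where ps: "e = (p, s)" "e' = (p', s')" by fastforce
    have ess: "essential_factor \<sigma> w (take (length p) ?\<pi>) (g e) (drop (length p + length w') ?\<pi>)"
      "essential_factor \<sigma> w (take (length p') ?\<pi>) (g e) (drop (length p' + length w') ?\<pi>)"
      using g(1)[of p s] g(1)[of p' s'] e ps by auto
    have "length q \<le> length ?\<pi>" if "(q, t) \<in> ?E" for q t
      using that length_subdivision[OF mor, of w] by auto
    then have "length p \<le> length ?\<pi>" "length p' \<le> length ?\<pi>" using e ps by blast+
    then have "length p = length p'"
      using hd_essential_factor[OF ess(1)] hd_essential_factor[OF ess(2)] by simp
    then show "e = e'" using e ps by auto
  qed
  moreover have "g ` ?E = ?U"
  proof
    show "g ` ?E \<subseteq> ?U"
    proof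
      fix u assume "u \<in> g ` ?E"
      then obtain p s where ps: "(p, s) \<in> ?E" "u = g (p, s)" by auto
      then show "u \<in> ?U"
        using g[OF ps(1)] covering_word_eq[OF ne g(1)[OF ps(1)]]
        by (auto simp: essential_factor_def sublist_def)
    qed
  next
    show "?U \<subseteq> g ` ?E"
    proof
      fix u assume u: "u \<in> ?U"
      then have "u \<noteq> []" using w' by (auto simp: letter_map_def)
      then obtain p s where ess: "essential_factor \<sigma> w p u s"
        using u essential_factor_covering_word by blast
      have lm: "letter_map \<sigma> (x @ y) = letter_map \<sigma> x @ letter_map \<sigma> y" for x y
        by (simp add: letter_map_def)
      have len: "length (letter_map \<sigma> x) = length x" for x by (simp add: letter_map_def)
      have "\<sigma> w = letter_map \<sigma> p @ w' @ letter_map \<sigma> s"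
        using letter_map_subdivision[OF mor, of w] ess u by (simp add: essential_factor_def lm)
      then have "(letter_map \<sigma> p, letter_map \<sigma> s) \<in> ?E"
        using ess len by (simp add: essential_factor_def)
      moreover have "u = g (letter_map \<sigma> p, letter_map \<sigma> s)"
        using ess u len[of u] len[of p] by (auto simp: essential_factor_def g_def)
      ultimately show "u \<in> g ` ?E" by (rule rev_image_eqI)
    qed
  qed
  ultimately show ?thesis
    using False card_image[of g ?E] unfolding essential_occurrences_def by simp
qed

lemma length_subdivision_ge_Min:
  fixes \<sigma> :: "'a::finite list \<Rightarrow> 'b list"
  shows "length v * Min (range (\<lambda>a. length (\<sigma> [a]))) \<le> length (subdivision \<sigma> v)"
proof (induction v)
  case (Cons a v)
  have "Min (range (\<lambda>a. length (\<sigma> [a]))) \<le> length (\<sigma> [a])" by simp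
  from add_mono[OF this Cons.IH] show ?case
    unfolding subdivision_Cons[of \<sigma> a v]
    by (simp only: length_Cons length_append mult_Suc length_subdivision_singleton)
qed simp

text \<open>
  If \<open>v\<close> has at least two letters, then \<open>u\<close> contains all inner blocks and at least one letter of
  each of the two outer blocks.  For shorter \<open>v\<close> the bound holds because it is at least 2.
\<close>

lemma essential_factor_imp_W:
  fixes \<sigma> :: "'a::finite list \<Rightarrow> 'b list"
  assumes ne: "non_erasing \<sigma>" and ess: "essential_factor \<sigma> v p u s"
    and len: "length u = length w'" "2 \<le> length w'"
  shows "v \<in> W \<sigma> w'"
proof -
  define m where "m = Min (range (\<lambda>a. length (\<sigma> [a])))"
  have m: "0 < m"
    using ne unfolding m_def by (subst Min_gr_iff) (auto simp: non_erasing_def Suc_le_eq)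
  show ?thesis
  proof (cases "length v \<le> 1")
    case True
    have "0 \<le> (real (length w') - 2) / real m" using len by simp
    then show ?thesis using True by (simp add: W_def m_def)
  next
    case False
    then obtain a r where r: "v = a # r" "r \<noteq> []" by (cases v) auto
    then obtain t b where v: "v = a # t @ [b]" by (cases r rule: rev_cases) auto
    have "length (subdivision \<sigma> v) = length (\<sigma> [a]) + length (subdivision \<sigma> t) + length (\<sigma> [b])"
      by (simp add: v subdivision_append length_subdivision_singleton subdivision_Cons[of \<sigma> a "t @ [b]"])
    then have "length (subdivision \<sigma> t) + 2 \<le> length u"
      using ess v by (simp add: essential_factor_def)
    then have "length t * m + 2 \<le> length w'"
      using length_subdivision_ge_Min[of t \<sigma>] len unfolding m_def by linarith
    then have "real (length t) * real m \<le> real (length w') - 2"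
      by (metis (mono_tags, lifting) le_diff_eq of_nat_add of_nat_le_iff of_nat_mult of_nat_numeral)
    then have "real (length t) \<le> (real (length w') - 2) / real m"
      using m by (simp add: pos_le_divide_eq)
    then show ?thesis by (simp add: W_def v m_def)
  qed
qed

lemma finite_W: "finite (W (\<sigma> :: 'a::finite list \<Rightarrow> 'b list) w')"
proof (rule finite_subset)
  let ?b = "(real (length w') - 2) / real (Min (range (\<lambda>a. length (\<sigma> [a])))) + 2"
  show "W \<sigma> w' \<subseteq> {w. set w \<subseteq> UNIV \<and> length w \<le> nat \<lfloor>?b\<rfloor>}"
    unfolding W_def
    by (intro subsetI CollectI conjI subset_UNIV le_nat_floor) (simp only: mem_Collect_eq)
  show "finite {w :: 'a list. set w \<subseteq> UNIV \<and> length w \<le> nat \<lfloor>?b\<rfloor>}"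
    by (rule finite_lists_length_le) simp
qed

theorem proposition1p4:
  fixes \<sigma> :: "'a::finite list \<Rightarrow> 'b::finite list"
    and \<mu> :: "(int \<Rightarrow> 'a) measure"
    and w' :: "'b list"
  assumes "monoid_morphism \<sigma>"
    and "non_erasing \<sigma>"
    and "\<mu> \<in> invariant_measures"
    and "length w' \<ge> 2"
  shows "finite (W \<sigma> w') \<and>
    measure (transfer \<sigma> \<mu>) (cylinder w') =
      (\<Sum>w\<in>W \<sigma> w'. real (essential_occurrences \<sigma> w w') * measure \<mu> (cylinder w))"
proof
  show "finite (W \<sigma> w')" by (rule finite_W)
  have w': "w' \<noteq> []" using assms(4) by auto
  let ?F = "{u \<in> lists (subdivision_alphabet \<sigma>). letter_map \<sigma> u = w'}"
  \<comment> \<open>Words without a covering word contribute zero to the defining sum.\<close>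
  let ?G = "{u. letter_map \<sigma> u = w' \<and> (\<exists>v. sublist u (subdivision \<sigma> v))}"
  have sub: "?G \<subseteq> ?F"
  proof
    fix u assume "u \<in> ?G"
    then obtain v where "letter_map \<sigma> u = w'" "set u \<subseteq> set (subdivision \<sigma> v)"
      using set_mono_sublist by blast
    then show "u \<in> ?F" using set_subdivision[of \<sigma> v] by auto
  qed
  have fin: "finite ?G" by (rule finite_subset[OF sub finite_letter_map_fibre])
  have "measure (transfer \<sigma> \<mu>) (cylinder w') = (\<Sum>u\<in>?F. covering_measure \<sigma> \<mu> u)"
    using measure_tower_measure_cylinder[OF assms(2,3) w']
    by (simp add: transfer_eq_tower_measure[OF assms(2,3)])
  also have "\<dots> = (\<Sum>u\<in>?G. measure \<mu> (cylinder (covering_word \<sigma> u)))"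
    by (rule sum.mono_neutral_cong_right[OF finite_letter_map_fibre sub])
       (auto simp: covering_measure_def)
  also have "\<dots> = (\<Sum>w\<in>W \<sigma> w'. \<Sum>u\<in>{u \<in> ?G. covering_word \<sigma> u = w}.
      measure \<mu> (cylinder (covering_word \<sigma> u)))"
  proof (rule sum.group[OF fin finite_W, symmetric])
    show "covering_word \<sigma> ` ?G \<subseteq> W \<sigma> w'"
    proof
      fix w assume "w \<in> covering_word \<sigma> ` ?G"
      then obtain u v where u: "letter_map \<sigma> u = w'" "sublist u (subdivision \<sigma> v)" "w = covering_word \<sigma> u"
        by blast
      have len: "length u = length w'" using u(1) by (auto simp: letter_map_def)
      then have "u \<noteq> []" using w' by auto
      then obtain p s where "essential_factor \<sigma> w p u s"
        using essential_factor_covering_word u(2,3) by metis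
      then show "w \<in> W \<sigma> w'" using essential_factor_imp_W assms(2,4) len by metis
    qed
  qed
  also have "\<dots> = (\<Sum>w\<in>W \<sigma> w'. real (essential_occurrences \<sigma> w w') * measure \<mu> (cylinder w))"
    by (simp add: essential_occurrences_eq_card[OF assms(1,2) w'] conj_assoc)
  finally show "measure (transfer \<sigma> \<mu>) (cylinder w') =
      (\<Sum>w\<in>W \<sigma> w'. real (essential_occurrences \<sigma> w w') * measure \<mu> (cylinder w))" .
qed

end
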